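(* Let $n\ge1$ and $i\in\{0,\dots,n-1\}$. Let $\bar W^i_n$ be the mean number of nodes at level $n-i-1$ in a semantic tree corresponding to a syntax tree of size $n$, i.e. the arithmetic mean over all plane rooted trees $T$ of size $n$ (each weighted equally) of the number of nodes at level $n-i-1$ of $\mathrm{Sem}(T)$. Then $$\bar W^i_n=\frac{2^i\,(2n-2i-1)!\,(n-1)!}{(2n-i-1)!\,(n-i-1)!}\cdot\frac{n!}{2^{n-1}\,i!}.$$
   Context: A syntax tree is a plane rooted tree, i.e. a rooted tree in which the children of each node are linearly ordered; its size is its number of nodes. The nodes of a given tree are regarded as carrying pairwise distinct names (actions), but trees are enumerated up to isomorphism of plane rooted trees (unlabelled). The root of a tree is at level $0$ and the children of a node at level $j$ are at level $j+1$. For a plane rooted tree $T$ whose root has children $v_1,\dots,v_r$ from left to right, and $1\le i\le r$, the $i$-contraction $T\lhd i$ is the plane tree with root $v_i$ whose root-subtrees are, from left to right, $T(v_1),\dots,T(v_{i-1}),T(v_{i_1}),\dots,T(v_{i_m}),T(v_{i+1}),\dots,T(v_r)$, where $T(v)$ is the subtree of all descendants of $v$ (including $v$) and $v_{i_1},\dots,v_{i_m}$ are the children of $v_i$ in order. The semantic tree $\mathrm{Sem}(T)$ is defined recursively: if $T$ is a single node, $\mathrm{Sem}(T)=T$; if $T$ has root $t$ with $r\ge1$ children, $\mathrm{Sem}(T)$ has root $t$ and root-subtrees $\mathrm{Sem}(T\lhd 1),\dots,\mathrm{Sem}(T\lhd r)$ from left to right. (All leaves of $\mathrm{Sem}(T)$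 are at level $n-1$ if $T$ has size $n$.) *)

theory Defs
  imports Complex_Main
begin

datatype 'a ptree = Node (name: 'a) (subtrees: "'a ptree list")

primrec num_nodes :: "'a ptree \<Rightarrow> nat" where
  "num_nodes (Node t ts) = Suc (sum_list (map num_nodes ts))"

fun level_count :: "'a ptree \<Rightarrow> nat \<Rightarrow> nat" where
  "level_count (Node t ts) 0 = 1"
| "level_count (Node t ts) (Suc k) = sum_list (map (\<lambda>T. level_count T k) ts)"

text \<open>Root-subtrees are numbered from 1 while lists are indexed from 0, so the child
  \<open>v\<^sub>i\<close> of the root of \<open>T\<close> is the root of \<open>subtrees T ! (i - 1)\<close>. The definition is
  meaningful only for \<open>1 \<le> i \<le> length (subtrees T)\<close>.\<close>

definition contraction :: "'a ptree \<Rightarrow> nat \<Rightarrow> 'a ptree" (infixl "\<lhd>" 70) where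
  "T \<lhd> i = (let V = subtrees T ! (i - 1)
             in Node (name V) (take (i - 1) (subtrees T) @ subtrees V @ drop i (subtrees T)))"

lemma num_nodes_contraction:
  assumes "1 \<le> i" "i \<le> length (subtrees T)"
  shows "num_nodes T = Suc (num_nodes (T \<lhd> i))"
proof -
  obtain j where i: "i = Suc j" using assms(1) by (cases i) auto
  obtain t ts where T: "T = Node t ts" by (cases T)
  have j: "j < length ts" using assms(2) i T by simp
  obtain v vs where V: "ts ! j = Node v vs" by (cases "ts ! j")
  have "map num_nodes ts = map num_nodes (take j ts @ ts ! j # drop (Suc j) ts)"
    using id_take_nth_drop[OF j] by simp
  then have "sum_list (map num_nodes ts) =
      sum_list (map num_nodes (take j ts)) + num_nodes (ts ! j)
      + sum_list (map num_nodes (drop (Suc j) ts))"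
    by simp
  then show ?thesis
    by (simp add: contraction_def T i V)
qed

text \<open>A single node is the case in which the list of root-subtrees is empty.\<close>

function sem :: "'a ptree \<Rightarrow> 'a ptree" where
  "sem T = Node (name T) (map (\<lambda>i. sem (T \<lhd> i)) [1..<Suc (length (subtrees T))])"
  by pat_completeness auto
termination
  by (relation "measure num_nodes") (auto simp: num_nodes_contraction)

declare sem.simps [simp del]

lemma contraction_map_ptree:
  assumes "1 \<le> i" "i \<le> length (subtrees T)"
  shows "map_ptree f T \<lhd> i = map_ptree f (T \<lhd> i)"
proof -
  have "i - 1 < length (subtrees T)" using assms by linarith
  then show ?thesis
    by (cases T; cases "subtrees T ! (i - 1)")
       (simp add: contraction_def take_map drop_map)
qed

lemma sem_map_ptree: "sem (map_ptree f T) = map_ptree f (sem T)"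
proof (induction T rule: sem.induct)
  case (1 T)
  have "sem (map_ptree f T \<lhd> i) = map_ptree f (sem (T \<lhd> i))"
    if "i \<in> set [1..<Suc (length (subtrees T))]" for i
  proof -
    have "1 \<le> i" "i \<le> length (subtrees T)" using that by auto
    then show ?thesis using 1[OF that] by (simp add: contraction_map_ptree)
  qed
  moreover have "name (map_ptree f T) = f (name T)"
    "subtrees (map_ptree f T) = map (map_ptree f) (subtrees T)"
    by (cases T; simp)+
  ultimately show ?case
    by (subst (1 2) sem.simps) (simp del: upt_Suc)
qed

lemma level_count_map_ptree: "level_count (map_ptree f T) k = level_count T k"
  by (induction T k rule: level_count.induct) (auto simp: o_def cong: map_cong)

text \<open>Trees up to isomorphism of plane rooted trees are represented by trees all of whose
  nodes carry the same name. The names do not influence the level counts of the semantic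
  tree: see \<open>sem_map_ptree\<close> and \<open>level_count_map_ptree\<close>.\<close>

definition plane_trees :: "nat \<Rightarrow> unit ptree set" where
  "plane_trees n = {T. num_nodes T = n}"

lemma num_nodes_pos: "0 < num_nodes T"
  by (cases T) simp

lemma finite_plane_trees: "finite (plane_trees n)"
proof (induction n rule: less_induct)
  case (less n)
  let ?A = "\<Union>m<n. plane_trees m"
  have "plane_trees n \<subseteq> Node () ` {ts. set ts \<subseteq> ?A \<and> length ts \<le> n}"
  proof
    fix T assume "T \<in> plane_trees n"
    then obtain ts where T: "T = Node () ts" and n: "n = Suc (sum_list (map num_nodes ts))"
      by (cases T) (auto simp: plane_trees_def)
    have "num_nodes x < n" if "x \<in> set ts" for x
      using member_le_sum_list[of "num_nodes x" "map num_nodes ts"] that n by simp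
    moreover have "length ts \<le> sum_list (map num_nodes ts)"
    proof (induction ts)
      case (Cons x xs)
      then show ?case using num_nodes_pos[of x] by simp
    qed simp
    ultimately show "T \<in> Node () ` {ts. set ts \<subseteq> ?A \<and> length ts \<le> n}"
      using T n by (auto simp: plane_trees_def)
  qed
  moreover have "finite ?A" using less by simp
  ultimately show ?case
    using finite_subset[OF _ finite_imageI[OF finite_lists_length_le]] by blast
qed

lemma plane_trees_nonempty:
  assumes "1 \<le> n"
  shows "plane_trees n \<noteq> {}"
proof -
  obtain m where "n = Suc m" using assms by (cases n) auto
  then have "Node () (replicate m (Node () [])) \<in> plane_trees n"
    by (simp add: plane_trees_def sum_list_replicate)
  then show ?thesis by blast
qed

definition mean_level_count :: "nat \<Rightarrow> nat \<Rightarrow> real" where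
  "mean_level_count i n =
     (\<Sum>T\<in>plane_trees n. real (level_count (sem T) (n - i - 1))) / real (card (plane_trees n))"

end

theory Submission imports Defs begin

text \<open>A plane tree \<open>T'\<close> whose root has \<open>r\<close> children arises as \<open>T \<lhd> i\<close> from exactly one \<open>T\<close>
  of each root degree \<open>d\<close> with \<open>i \<le> d \<le> r + 1\<close>: the child that was contracted takes
  \<open>r + 1 - d\<close> consecutive subtrees of \<open>T'\<close>, starting at the \<open>i\<close>-th one. Hence, summed over
  the trees of a given size, the weight \<open>d + q choose q\<close> times the number of nodes of the
  semantic tree at level \<open>k + 1\<close> equals \<open>q + 1\<close> times the corresponding sum for the weight
  \<open>d + (q + 2) choose (q + 2)\<close>, the level \<open>k\<close> and trees with one node less. Starting from
  \<open>q = 0\<close> this removes \<open>k = n - i - 1\<close> nodes and leaves the binomial moment of order \<open>2 k\<close> of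
  the root degree of trees of size \<open>i + 1\<close>. The same decomposition gives a recurrence for these
  binomial moments, which is solved by the ballot numbers.\<close>

abbreviation root_degree :: "'a ptree \<Rightarrow> nat" where
  "root_degree T \<equiv> length (subtrees T)"

lemma plane_trees_1: "plane_trees (Suc 0) = {Node () []}"
proof -
  have "T = Node () []" if "num_nodes T = Suc 0" for T :: "unit ptree"
  proof (cases T)
    case (Node t ts)
    then show ?thesis using that num_nodes_pos[of "hd ts"] by (cases ts) auto
  qed
  then show ?thesis by (auto simp: plane_trees_def)
qed

lemma root_degree_pos:
  assumes "T \<in> plane_trees (Suc (Suc n))"
  shows "1 \<le> root_degree T"
  using assms by (cases T; cases "subtrees T") (auto simp: plane_trees_def)

text \<open>The value is meaningful only for \<open>1 \<le> i\<close>, \<open>i \<le> d\<close> and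
  \<open>d \<le> Suc (root_degree T)\<close>; then \<open>i - 1 + m\<close> does not exceed the root
  degree, so all \<open>m\<close> subtrees to be grouped exist.\<close>

definition uncontraction :: "unit ptree \<Rightarrow> nat \<Rightarrow> nat \<Rightarrow> unit ptree" where
  "uncontraction T d i = (let ts = subtrees T; m = Suc (length ts) - d
     in Node () (take (i - 1) ts @ Node () (take m (drop (i - 1) ts)) # drop (i - 1 + m) ts))"

lemma root_degree_uncontraction:
  assumes "1 \<le> i" "i \<le> d" "d \<le> Suc (root_degree T)"
  shows "root_degree (uncontraction T d i) = d"
  using assms by (simp add: uncontraction_def Let_def min_def) linarith

lemma contraction_uncontraction:
  assumes "1 \<le> i" "i \<le> d" "d \<le> Suc (root_degree T)"
  shows "uncontraction T d i \<lhd> i = T"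
proof -
  obtain j where i: "i = Suc j" using assms(1) by (cases i) auto
  obtain ts where T: "T = Node () ts" by (cases T) auto
  have j: "min (length ts) j = j" using assms i T by simp
  have "take j ts @ take m (drop j ts) @ drop (j + m) ts = ts" for m
    by (metis append_take_drop_id drop_drop add.commute)
  then show ?thesis
    by (simp add: uncontraction_def contraction_def Let_def i T nth_append j)
qed

lemma uncontraction_contraction:
  fixes T :: "unit ptree"
  assumes "1 \<le> i" "i \<le> root_degree T"
  shows "uncontraction (T \<lhd> i) (root_degree T) i = T"
proof -
  obtain j where i: "i = Suc j" using assms(1) by (cases i) auto
  obtain ts where T: "T = Node () ts" by (cases T) auto
  have j: "j < length ts" using assms i T by simp
  obtain vs where V: "ts ! j = Node () vs" by (cases "ts ! j") auto
  have "ts = take j ts @ Node () vs # drop (Suc j) ts"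
    using id_take_nth_drop[OF j] V by simp
  \<comment> \<open>The left side is the number \<open>m\<close> in \<open>uncontraction\<close>, so
    exactly the children of the contracted node are regrouped.\<close>
  moreover have "Suc (length vs + j + (length ts - Suc j)) - length ts = length vs"
    using j by simp
  ultimately show ?thesis
    using j by (simp add: uncontraction_def contraction_def Let_def i T V min_def)
qed

lemma root_degree_contraction:
  assumes "1 \<le> i" "i \<le> root_degree T"
  shows "root_degree T \<le> Suc (root_degree (T \<lhd> i))"
  using assms by (cases i) (auto simp: contraction_def Let_def)

text \<open>The map from \<open>(T, i)\<close> to \<open>(T \<lhd> i, root_degree T, i)\<close> is a
  bijection. As \<open>g\<close> does not see \<open>i\<close>, each pair \<open>(T, d)\<close> on
  the right is counted \<open>d\<close> times.\<close>

lemma sum_contractions: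
  fixes g :: "unit ptree \<Rightarrow> nat \<Rightarrow> real"
  shows "(\<Sum>T\<in>plane_trees (Suc n). \<Sum>i=1..root_degree T. g (T \<lhd> i) (root_degree T)) =
         (\<Sum>T\<in>plane_trees n. \<Sum>d=1..Suc (root_degree T). real d * g T d)"
proof -
  let ?A = "SIGMA T:plane_trees (Suc n). {1..root_degree T}"
  let ?B = "SIGMA T:plane_trees n. SIGMA d:{1..Suc (root_degree T)}. {1..d}"
  have "(\<Sum>T\<in>plane_trees (Suc n). \<Sum>i=1..root_degree T. g (T \<lhd> i) (root_degree T)) =
        (\<Sum>(T, i)\<in>?A. g (T \<lhd> i) (root_degree T))"
    by (subst sum.Sigma) (auto simp: finite_plane_trees)
  also have "\<dots> = (\<Sum>(T, d, i)\<in>?B. g T d)"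
  proof (rule sum.reindex_bij_witness
      [where j = "\<lambda>(T, i). (T \<lhd> i, root_degree T, i)"
         and i = "\<lambda>(T, d, i). (uncontraction T d i, i)"])
    fix a assume "a \<in> ?A"
    then obtain T i where a: "a = (T, i)" and n: "num_nodes T = Suc n"
      and i: "1 \<le> i" "i \<le> root_degree T"
      by (auto simp: plane_trees_def)
    show "(case case a of (T, i) \<Rightarrow> (T \<lhd> i, root_degree T, i) of
        (T, d, i) \<Rightarrow> (uncontraction T d i, i)) = a"
      using i by (simp add: a uncontraction_contraction)
    show "(case a of (T, i) \<Rightarrow> (T \<lhd> i, root_degree T, i)) \<in> ?B"
      using i n num_nodes_contraction[OF i] root_degree_contraction[OF i]
      by (simp add: a plane_trees_def)
    show "(case case a of (T, i) \<Rightarrow> (T \<lhd> i, root_degree T, i) of (T, d, i) \<Rightarrow> g T d) =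
        (case a of (T, i) \<Rightarrow> g (T \<lhd> i) (root_degree T))"
      by (simp add: a)
  next
    fix b assume "b \<in> ?B"
    then obtain T d i where b: "b = (T, d, i)" and n: "num_nodes T = n"
      and i: "1 \<le> i" "i \<le> d" "d \<le> Suc (root_degree T)"
      by (auto simp: plane_trees_def)
    note deg = root_degree_uncontraction[OF i] and contr = contraction_uncontraction[OF i]
    show "(case case b of (T, d, i) \<Rightarrow> (uncontraction T d i, i) of
        (T, i) \<Rightarrow> (T \<lhd> i, root_degree T, i)) = b"
      by (simp add: b deg contr)
    \<comment> \<open>The size comes from contracting back to \<open>T\<close>, which loses one
      node, and not from counting subtrees.\<close>
    have "num_nodes (uncontraction T d i) = Suc n"
      using num_nodes_contraction[of i "uncontraction T d i"] i n by (simp add: deg contr)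
    then show "(case b of (T, d, i) \<Rightarrow> (uncontraction T d i, i)) \<in> ?A"
      using i by (simp add: b deg plane_trees_def)
  qed
  also have "\<dots> = (\<Sum>T\<in>plane_trees n. \<Sum>(d, i)\<in>(SIGMA d:{1..Suc (root_degree T)}. {1..d}). g T d)"
    by (subst sum.Sigma) (auto simp: finite_plane_trees)
  also have "\<dots> = (\<Sum>T\<in>plane_trees n. \<Sum>d=1..Suc (root_degree T). real d * g T d)"
  proof (intro sum.cong refl)
    fix T :: "unit ptree"
    show "(\<Sum>(d, i)\<in>(SIGMA d:{1..Suc (root_degree T)}. {1..d}). g T d) =
        (\<Sum>d=1..Suc (root_degree T). real d * g T d)"
      by (subst sum.Sigma[symmetric]) auto
  qed
  finally show ?thesis .
qed

lemma sum_root_degree_Suc: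
  fixes w :: "nat \<Rightarrow> real"
  shows "(\<Sum>T\<in>plane_trees (Suc (Suc n)). w (root_degree T)) =
         (\<Sum>T\<in>plane_trees (Suc n). \<Sum>d=1..Suc (root_degree T). w d)"
proof -
  \<comment> \<open>The weight is spread evenly over the contractions of \<open>T\<close>, which
    exist because \<open>T\<close> has at least two nodes; this cancels the factor \<open>d\<close>
    in \<open>sum_contractions\<close>.\<close>
  have "(\<Sum>T\<in>plane_trees (Suc (Suc n)). w (root_degree T)) =
      (\<Sum>T\<in>plane_trees (Suc (Suc n)). \<Sum>i=1..root_degree T. w (root_degree T) / real (root_degree T))"
  proof (rule sum.cong[OF refl])
    fix T assume "T \<in> plane_trees (Suc (Suc n))"
    from root_degree_pos[OF this]
    show "w (root_degree T) = (\<Sum>i=1..root_degree T. w (root_degree T) / real (root_degree T))"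
      by auto
  qed
  also have "\<dots> = (\<Sum>T\<in>plane_trees (Suc n). \<Sum>d=1..Suc (root_degree T). real d * (w d / real d))"
    by (rule sum_contractions)
  also have "\<dots> = (\<Sum>T\<in>plane_trees (Suc n). \<Sum>d=1..Suc (root_degree T). w d)"
    by (intro sum.cong) auto
  finally show ?thesis .
qed

lemma level_count_sem_0: "level_count (sem T) 0 = 1"
  by (subst sem.simps) simp

lemma level_count_sem_Suc:
  "level_count (sem T) (Suc k) = (\<Sum>i=1..root_degree T. level_count (sem (T \<lhd> i)) k)"
  by (subst sem.simps)
     (simp add: o_def interv_sum_list_conv_sum_set_nat atLeastLessThanSuc_atLeastAtMost
           del: upt_Suc)

lemma sum_level_count_Suc:
  fixes w :: "nat \<Rightarrow> real"
  shows "(\<Sum>T\<in>plane_trees (Suc n). w (root_degree T) * real (level_count (sem T) (Suc k))) =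
         (\<Sum>T\<in>plane_trees n. (\<Sum>d=1..Suc (root_degree T). real d * w d)
            * real (level_count (sem T) k))"
  using sum_contractions[where g = "\<lambda>T d. w d * real (level_count (sem T) k)"]
  by (simp add: level_count_sem_Suc sum_distrib_left sum_distrib_right mult.assoc
           del: sum.cl_ivl_Suc)

text \<open>The hockey-stick identity, starting at its first nonzero term.\<close>

lemma sum_choose_shifted: "(\<Sum>d=1..Suc r. (d + q) choose Suc q) = (r + q + 2) choose (q + 2)"
  by (induction r) simp_all

text \<open>Both sides equal \<open>(d + q) * ((d + q - 1) choose q)\<close>. This turns the factor
  \<open>d\<close> from \<open>sum_contractions\<close> into a constant, so that the hockey-stick
  identity applies.\<close>

lemma absorption_shifted: "d * ((d + q) choose q) = Suc q * ((d + q) choose Suc q)"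
  using binomial_absorb_comp[of "d + q" q] binomial_absorption[of q "d + q"] by simp

definition binomial_moment :: "nat \<Rightarrow> nat \<Rightarrow> real" where
  "binomial_moment q n = (\<Sum>T\<in>plane_trees (Suc n). real ((root_degree T + q) choose q))"

lemma binomial_moment_n_0: "binomial_moment q 0 = 1"
  by (simp add: binomial_moment_def plane_trees_1)

lemma binomial_moment_0_Suc: "binomial_moment 0 (Suc n) = binomial_moment 1 n"
  using sum_root_degree_Suc[of "\<lambda>_. 1" n] by (simp add: binomial_moment_def)

text \<open>Pascal's rule splits the weight; removing a node from the second part and summing over
  \<open>d\<close> raises its order to \<open>q + 2\<close>.\<close>

lemma binomial_moment_Suc_Suc:
  "binomial_moment (Suc q) (Suc n) = binomial_moment q (Suc n) + binomial_moment (q + 2) n"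
proof -
  let ?w = "\<lambda>d. real ((d + q) choose Suc q)"
  have "binomial_moment (Suc q) (Suc n) = binomial_moment q (Suc n)
      + (\<Sum>T\<in>plane_trees (Suc (Suc n)). ?w (root_degree T))"
    by (simp add: binomial_moment_def sum.distrib)
  also have "(\<Sum>T\<in>plane_trees (Suc (Suc n)). ?w (root_degree T)) =
      (\<Sum>T\<in>plane_trees (Suc n). real (\<Sum>d=1..Suc (root_degree T). (d + q) choose Suc q))"
    unfolding of_nat_sum by (rule sum_root_degree_Suc)
  also have "\<dots> = binomial_moment (q + 2) n"
    unfolding sum_choose_shifted binomial_moment_def by (simp add: add.assoc)
  finally show ?thesis .
qed

text \<open>Ballot numbers, with the Catalan numbers at \<open>q = 0\<close>. The recurrence lowers
  \<open>n\<close> while raising the order, or lowers \<open>q\<close> at fixed \<open>n\<close>;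
  hence the nested inductions with \<open>q\<close> arbitrary in the outer one.\<close>

lemma binomial_moment_eq:
  "binomial_moment q n = real (Suc q) * fact (2 * n + q) / (fact n * fact (Suc (n + q)))"
proof (induction n arbitrary: q)
  case 0
  then show ?case by (simp add: binomial_moment_n_0)
next
  case (Suc n)
  note IH = Suc
  show ?case
  proof (induction q)
    case 0
    show ?case
      unfolding binomial_moment_0_Suc IH by (simp add: divide_simps)
  next
    case (Suc q)
    show ?case
      unfolding binomial_moment_Suc_Suc Suc IH
      by (simp add: divide_simps) (simp add: algebra_simps)
  qed
qed

text \<open>The prefactor is the product of the odd numbers below \<open>2 * j\<close>; it absorbs
  the factor \<open>2 * j + 1\<close> that each removed node yields.\<close>

lemma sum_weighted_level_count:
  "fact (2 * j) / (2 ^ j * fact j) *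
     (\<Sum>T\<in>plane_trees (Suc (n + k)).
        real ((root_degree T + 2 * j) choose (2 * j)) * real (level_count (sem T) k)) =
   fact (2 * (j + k)) / (2 ^ (j + k) * fact (j + k)) * binomial_moment (2 * (j + k)) n"
proof (induction k arbitrary: j)
  case 0
  then show ?case by (simp add: level_count_sem_0 binomial_moment_def)
next
  case (Suc k)
  let ?c = "\<lambda>j. fact (2 * j) / (2 ^ j * fact j) :: real"
  have inner: "(\<Sum>d=1..Suc r. real d * real ((d + 2 * j) choose (2 * j))) =
      real (Suc (2 * j)) * real ((r + 2 * Suc j) choose (2 * Suc j))" for r
  proof -
    have "(\<Sum>d=1..Suc r. d * ((d + 2 * j) choose (2 * j))) =
        Suc (2 * j) * ((r + 2 * j + 2) choose (2 * j + 2))"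
      unfolding absorption_shifted sum_distrib_left[symmetric] sum_choose_shifted ..
    then have "real (\<Sum>d=1..Suc r. d * ((d + 2 * j) choose (2 * j))) =
        real (Suc (2 * j) * ((r + 2 * j + 2) choose (2 * j + 2)))"
      by presburger
    then show ?thesis
      unfolding of_nat_sum of_nat_mult by (simp add: add.assoc)
  qed
  have c: "?c j * real (Suc (2 * j)) = ?c (Suc j)"
    by (simp add: divide_simps)
  have "?c j * (\<Sum>T\<in>plane_trees (Suc (n + Suc k)).
        real ((root_degree T + 2 * j) choose (2 * j)) * real (level_count (sem T) (Suc k))) =
      ?c j * (real (Suc (2 * j)) * (\<Sum>T\<in>plane_trees (Suc (n + k)).
        real ((root_degree T + 2 * Suc j) choose (2 * Suc j)) * real (level_count (sem T) k)))"
    using sum_level_count_Suc[where w = "\<lambda>d. real ((d + 2 * j) choose (2 * j))"]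
    unfolding inner by (simp only: add_Suc_right sum_distrib_left mult.assoc)
  also have "\<dots> = ?c (Suc j) * (\<Sum>T\<in>plane_trees (Suc (n + k)).
        real ((root_degree T + 2 * Suc j) choose (2 * Suc j)) * real (level_count (sem T) k))"
    unfolding c[symmetric] by (simp only: mult.assoc)
  also have "\<dots> = ?c (j + Suc k) * binomial_moment (2 * (j + Suc k)) n"
    unfolding Suc.IH[of "Suc j"] by simp
  finally show ?case .
qed

theorem theorem24:
  fixes n i :: nat
  assumes "1 \<le> n" and "i \<in> {0..n - 1}"
  shows "mean_level_count i n =
    (2 ^ i * fact (2 * n - 2 * i - 1) * fact (n - 1)) / (fact (2 * n - i - 1) * fact (n - i - 1))
      * (fact n / (2 ^ (n - 1) * fact i))"
proof -
  define k where "k = n - i - 1"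
  have n: "n = Suc (i + k)" using assms by (simp add: k_def)
  have ix: "n - i - 1 = k" "2 * n - 2 * i - 1 = Suc (2 * k)" "n - 1 = i + k"
    "2 * n - i - 1 = Suc (i + 2 * k)"
    using n by auto
  have card: "real (card (plane_trees n)) = fact (2 * (i + k)) / (fact (i + k) * fact n)"
    using binomial_moment_eq[of 0 "i + k"] by (simp add: binomial_moment_def n)
  \<comment> \<open>At \<open>j = 0\<close> the weight and the prefactor are both 1.\<close>
  have sum: "(\<Sum>T\<in>plane_trees n. real (level_count (sem T) k)) =
      fact (2 * k) / (2 ^ k * fact k) *
        (real (Suc (2 * k)) * fact (2 * (i + k)) / (fact i * fact (Suc (i + 2 * k))))"
    using sum_weighted_level_count[where j = 0 and n = i and k = k] binomial_moment_eq[of "2 * k" i]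
    by (simp add: n)
  have odd: "fact (Suc (2 * k)) = real (Suc (2 * k)) * fact (2 * k)" by simp
  show ?thesis
    unfolding mean_level_count_def ix sum card odd
    by (simp add: divide_simps power_add del: fact_Suc)
qed

end
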